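(* Consider a general hidden Markov model with parameter $\theta\in\Theta\subseteq\mathbf{R}^q$ and true parameter $\theta_0$, and assume that conditions C1--C2 hold with $r=0$. For any $\theta_1\in N_\delta(\theta_0)$ let $$K(\theta_1,\theta_0)=\lim_{n\to\infty}\frac1n\left[\log L(\theta_1;Y_{0:n})-\log L(\theta_0;Y_{0:n})\right]\qquad P^{\theta_1}\text{-a.s.}$$ be the Kullback-Leibler divergence. Then: 1. (Non-negativity) $K(\theta_1,\theta_0)\ge0$. 2. (Additivity) Suppose $Y_{0:n}=(Y^1_{0:n},Y^2_{0:n})$ and, for any $n\in\mathbb N$ and $y_{0:n}=(y^1_{0:n},y^2_{0:n})$, $L(\theta;y_{0:n})=L(\theta;y^1_{0:n})\,L(\theta;y^2_{0:n})$ for $\theta=\theta_0,\theta_1$. Then $$K(\theta_1,\theta_0)=K_1(\theta_1,\theta_0)+K_2(\theta_1,\theta_0),$$ where for $i=1,2$, $K_i$ is the Kullback-Leibler divergence defined by replacing $L(\theta;Y_{0:n})$ in the definition of $K$ by $L(\theta;Y^i_{0:n})$.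
   Context: **Model.** $\{X_n,n\ge0\}$ is a Markov chain on a general state space $\mathcal X$ with a $\sigma$-finite measure $Q$, having transition density $p_\theta(x,\cdot)$ and stationary density $\pi_\theta$ with respect to $Q$, $\theta\in\Theta\subseteq\mathbf{R}^q$. The observations $Y_n\in\mathbf{R}^d$ are such that, given everything else, $Y_n$ depends only on $X_n$ and $Y_{n-1}$: $f(\cdot;\theta|x,y)$ is the density (w.r.t. a $\sigma$-finite measure $\tilde Q$ on $\mathbf{R}^d$) of $Y_n$ given $X_n=x,Y_{n-1}=y$, and $f(\cdot;\theta|x_0)$ is the density of $Y_0$ given $X_0=x_0$. $P^\theta,E^\theta$ are the resulting law and expectation; $E^\theta_{(x,y)}$ is the expectation under initial state $(X_0,Y_0)=(x,y)$. The likelihood is $$L(\theta;Y_{0:n})=\int_{\mathcal X}\!\cdots\!\int_{\mathcal X}\pi_\theta(x_0)f(Y_0;\theta|x_0)\prod_{t=1}^n p_\theta(x_{t-1},x_t)f(Y_t;\theta|x_t,Y_{t-1})\,Q(dx_n)\cdots Q(dx_0),$$ with $Y_{0:n}=(Y_0,\dots,Y_n)$. In the additivity statement, $L(\theta;y^i_{0:n})$ denotes the likelihood of the component $Y^i_{0:n}$. $N_\delta(\theta_0)=\{\theta:\|\theta-\theta_0\|<\delta\}$ for some $\delta>0$. **Conditions.** C1. For a given $\theta\in\Theta$, the Markov chain $\{(X_n,Y_n)\}$ is aperiodic, irreducible, and for some weight function $w:\mathcal X\times\mathbf{R}^d\to[1,\infty)$ and $p\ge1$, $\lim_{n}\sup_{x,y,|h|\le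 w}\big|E^\theta_{(x,y)}[h(X_n,Y_n)]-\int h\,d\Pi_\theta\big|/w(x,y)=0$ (with $\Pi_\theta$ the stationary law of $(X_n,Y_n)$) and $\sup_{(x,y)}E^\theta_{(x,y)}[w(X_p,Y_p)]/w(x,y)<\infty$. Moreover $0<p_\theta(x_0,x_1)<\infty$ for all $x_0,x_1$; $0<\sup_{x}f(y_1;\theta|x,y_0)<\infty$ for all $y_0,y_1$; with pairwise disjoint $\mathcal X_n$, $\mathcal X=\bigcup_{n\ge1}\mathcal X_n$, $0<Q(\mathcal X_n)<\infty$, one has $E^\theta[\sum_{n\ge1}2^{-n}\sup_{x\in\mathcal X_n}f(Y_1;\theta|x,y_0)]<\infty$ for all $y_0$; and with $\tilde f_\theta(y_0,y_1)=\sup_{x_0}\int p_\theta(x_0,x)f(y_1;\theta|x,y_0)Q(dx)$ there is $p\ge1$ with $\sup_{(x_0,y_0)}E^\theta_{(x_0,y_0)}\log\big((\tilde f_\theta(y_0,Y_1))^p\,w(X_p,Y_p)/w(x_0,y_0)\big)<0$ and $\sup_{(x_0,y_0)}E^\theta_{(x_0,y_0)}\big\{\tilde f_\theta(y_0,Y_1)\,w(X_1,Y_1)/w(x_0,y_0)\big\}<\infty$. C2 with $r=0$. $\theta_0$ is an interior point of $\Theta$, and $\theta\mapsto p_\theta(x_0,x)$ and $\theta\mapsto\pi_\theta(x_0)$ are continuous in $N_\delta(\theta_0)$ for all $x_0,x\in\mathcal X$. (For general $r$, C2 also asks that all partial derivatives in $\theta$ of the densities $f$ up to order $r$ exist, and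 that $p_\theta,\pi_\theta$ have continuous derivatives of order $r$; for $r=0$ this reduces to $\theta_0$ being an interior point of $\Theta$ together with the continuity of $\theta\mapsto p_\theta(x_0,x)$ and $\theta\mapsto\pi_\theta(x_0)$ in $N_\delta(\theta_0)$.) *)

theory Defs
  imports "HOL-Probability.Probability"
begin

subsection \<open>Hidden Markov models\<close>

text \<open>
  The state space is the space of \<open>Qx\<close>; observations live in a Euclidean space with reference
  measure \<open>Qy\<close>.
  \<^item> \<open>trans_dens H \<theta> x x'\<close> is \<open>p\<^sub>\<theta>(x, x')\<close> and \<open>stat_dens H \<theta> x\<close> is \<open>\<pi>\<^sub>\<theta>(x)\<close>;
  \<^item> \<open>emit_dens H \<theta> x y y'\<close> is \<open>f(y'; \<theta> | x, y)\<close>: the \<^emph>\<open>last\<close> argument is the new observation and \<open>y\<close>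
    the previous one;
  \<^item> \<open>emit0_dens H \<theta> x y\<close> is \<open>f(y; \<theta> | x)\<close>, the density of the initial observation.
\<close>

record ('q, 'x, 'y) hmm =
  Params :: "'q set"
  Qx :: "'x measure"
  Qy :: "'y measure"
  trans_dens :: "'q \<Rightarrow> 'x \<Rightarrow> 'x \<Rightarrow> real"
  stat_dens :: "'q \<Rightarrow> 'x \<Rightarrow> real"
  emit_dens :: "'q \<Rightarrow> 'x \<Rightarrow> 'y \<Rightarrow> 'y \<Rightarrow> real"
  emit0_dens :: "'q \<Rightarrow> 'x \<Rightarrow> 'y \<Rightarrow> real"

definition prob_density :: "'a measure \<Rightarrow> ('a \<Rightarrow> real) \<Rightarrow> bool" where
  "prob_density M g \<longleftrightarrow>
     g \<in> borel_measurable M \<and> (\<forall>x\<in>space M. 0 \<le> g x) \<and> (\<integral>\<^sup>+x. ennreal (g x) \<partial>M) = 1"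

definition stationary :: "('a \<Rightarrow> 'a measure) \<Rightarrow> 'a measure \<Rightarrow> bool" where
  "stationary N \<mu> \<longleftrightarrow>
     prob_space \<mu> \<and> (\<forall>A\<in>sets \<mu>. (\<integral>\<^sup>+x. emeasure (N x) A \<partial>\<mu>) = emeasure \<mu> A)"

definition valid_hmm :: "('q::euclidean_space, 'x, 'y::euclidean_space) hmm \<Rightarrow> bool" where
  "valid_hmm H \<longleftrightarrow>
     sigma_finite_measure (Qx H) \<and> sigma_finite_measure (Qy H) \<and> sets (Qy H) = sets borel \<and>
     (\<forall>\<theta>\<in>Params H.
        (\<lambda>(x, x'). trans_dens H \<theta> x x') \<in> borel_measurable (Qx H \<Otimes>\<^sub>M Qx H) \<and>
        (\<forall>x\<in>space (Qx H). prob_density (Qx H) (trans_dens H \<theta> x)) \<and>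
        prob_density (Qx H) (stat_dens H \<theta>) \<and>
        stationary (\<lambda>x. density (Qx H) (\<lambda>x'. ennreal (trans_dens H \<theta> x x')))
                   (density (Qx H) (\<lambda>x. ennreal (stat_dens H \<theta> x))) \<and>
        (\<lambda>(x, y, y'). emit_dens H \<theta> x y y') \<in> borel_measurable (Qx H \<Otimes>\<^sub>M Qy H \<Otimes>\<^sub>M Qy H) \<and>
        (\<forall>x\<in>space (Qx H). \<forall>y. prob_density (Qy H) (emit_dens H \<theta> x y)) \<and>
        (\<lambda>(x, y). emit0_dens H \<theta> x y) \<in> borel_measurable (Qx H \<Otimes>\<^sub>M Qy H) \<and>
        (\<forall>x\<in>space (Qx H). prob_density (Qy H) (emit0_dens H \<theta> x)))"

subsection \<open>The law of the process\<close>

abbreviation joint :: "('q, 'x, 'y) hmm \<Rightarrow> ('x \<times> 'y) measure" where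
  "joint H \<equiv> Qx H \<Otimes>\<^sub>M Qy H"

text \<open>One-step transition kernel of \<open>(X\<^sub>n, Y\<^sub>n)\<close>.\<close>

definition hmm_kernel :: "('q, 'x, 'y) hmm \<Rightarrow> 'q \<Rightarrow> 'x \<times> 'y \<Rightarrow> ('x \<times> 'y) measure" where
  "hmm_kernel H \<theta> = (\<lambda>(x, y). density (joint H)
     (\<lambda>(x', y'). ennreal (trans_dens H \<theta> x x') * ennreal (emit_dens H \<theta> x' y y')))"

definition hmm_step :: "('q, 'x, 'y) hmm \<Rightarrow> 'q \<Rightarrow> ('x \<times> 'y) measure \<Rightarrow>
    nat \<Rightarrow> (nat \<Rightarrow> 'x \<times> 'y) \<Rightarrow> ('x \<times> 'y) measure" where
  "hmm_step H \<theta> \<mu> n \<omega> = (case n of 0 \<Rightarrow> \<mu> | Suc m \<Rightarrow> hmm_kernel H \<theta> (\<omega> m))"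

text \<open>
  The Ionescu-Tulcea measure on the path space \<open>nat \<Rightarrow> 'x \<times> 'y\<close> of the chain with initial law \<open>\<mu>\<close>.
  On a path \<open>\<omega>\<close> the processes are \<open>X\<^sub>n = fst (\<omega> n)\<close> and \<open>Y\<^sub>n = snd (\<omega> n)\<close>.
\<close>

definition path_law :: "('q, 'x, 'y) hmm \<Rightarrow> 'q \<Rightarrow> ('x \<times> 'y) measure \<Rightarrow> (nat \<Rightarrow> 'x \<times> 'y) measure" where
  "path_law H \<theta> \<mu> =
     projective_family.lim UNIV (Ionescu_Tulcea.CI (hmm_step H \<theta> \<mu>) (\<lambda>_. joint H)) (\<lambda>_. joint H)"

text \<open>\<open>P\<^sup>\<theta>\<close>: the initial law is the one appearing in the likelihood, with \<open>X\<^sub>0\<close> stationary.\<close>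

definition hmm_law :: "('q, 'x, 'y) hmm \<Rightarrow> 'q \<Rightarrow> (nat \<Rightarrow> 'x \<times> 'y) measure" where
  "hmm_law H \<theta> = path_law H \<theta>
     (density (joint H) (\<lambda>(x, y). ennreal (stat_dens H \<theta> x) * ennreal (emit0_dens H \<theta> x y)))"

definition hmm_law_from :: "('q, 'x, 'y) hmm \<Rightarrow> 'q \<Rightarrow> 'x \<times> 'y \<Rightarrow> (nat \<Rightarrow> 'x \<times> 'y) measure" where
  "hmm_law_from H \<theta> z = path_law H \<theta> (return (joint H) z)"

subsection \<open>Extended logarithm and expectation\<close>

text \<open>
  Unlike for \<^term>\<open>ln :: real \<Rightarrow> real\<close>, here \<open>log 0 = -\<infinity>\<close>: a likelihood may vanish at the wrong
  parameter.
\<close>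

definition elog :: "ennreal \<Rightarrow> ereal" where
  "elog u = (if u = 0 then -\<infinity> else if u = \<infinity> then \<infinity> else ereal (ln (enn2real u)))"

text \<open>
  Expectation of an extended real random variable as difference of those of its positive and
  negative parts. Since \<open>\<infinity> - \<infinity> = \<infinity>\<close> in \<^typ>\<open>ereal\<close>, it is below \<open>\<infinity>\<close> only if the positive part is
  integrable.
\<close>

definition expect :: "'w measure \<Rightarrow> ('w \<Rightarrow> ereal) \<Rightarrow> ereal" where
  "expect M h = enn2ereal (\<integral>\<^sup>+\<omega>. e2ennreal (h \<omega>) \<partial>M) - enn2ereal (\<integral>\<^sup>+\<omega>. e2ennreal (- h \<omega>) \<partial>M)"

subsection \<open>Irreducibility, aperiodicity and weighted ergodicity\<close>

text \<open>The usual notions for chains on general state spaces (Meyn and Tweedie).\<close>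

definition irreducibility_measure ::
    "('q, 'x, 'y) hmm \<Rightarrow> 'q \<Rightarrow> ('x \<times> 'y) measure \<Rightarrow> bool" where
  "irreducibility_measure H \<theta> \<phi> \<longleftrightarrow>
     sigma_finite_measure \<phi> \<and> sets \<phi> = sets (joint H) \<and> emeasure \<phi> (space \<phi>) \<noteq> 0 \<and>
     (\<forall>z\<in>space (joint H). \<forall>A\<in>sets (joint H). emeasure \<phi> A > 0 \<longrightarrow>
        (\<exists>n\<ge>1. emeasure (hmm_law_from H \<theta> z) {\<omega>\<in>space (hmm_law_from H \<theta> z). \<omega> n \<in> A} > 0))"

definition irreducible_chain :: "('q, 'x, 'y) hmm \<Rightarrow> 'q \<Rightarrow> bool" where
  "irreducible_chain H \<theta> \<longleftrightarrow> (\<exists>\<phi>. irreducibility_measure H \<theta> \<phi>)"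

definition hmm_cycle :: "('q, 'x, 'y) hmm \<Rightarrow> 'q \<Rightarrow> nat \<Rightarrow> (nat \<Rightarrow> ('x \<times> 'y) set) \<Rightarrow> bool" where
  "hmm_cycle H \<theta> d D \<longleftrightarrow>
     (\<forall>i<d. D i \<in> sets (joint H)) \<and> disjoint_family_on D {..<d} \<and>
     (\<forall>i<d. \<forall>z\<in>D i. emeasure (hmm_kernel H \<theta> z) (D (Suc i mod d)) = 1)"

definition aperiodic_chain :: "('q, 'x, 'y) hmm \<Rightarrow> 'q \<Rightarrow> bool" where
  "aperiodic_chain H \<theta> \<longleftrightarrow>
     (\<forall>\<phi> d D. irreducibility_measure H \<theta> \<phi> \<and> 2 \<le> d \<and> hmm_cycle H \<theta> d D \<longrightarrow>
        emeasure \<phi> (space (joint H) - (\<Union>i<d. D i)) \<noteq> 0)"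

text \<open>
  The integrability requirements say that the expectations in the limit exist; without them the
  Bochner integrals would be \<open>0\<close> by convention.
\<close>

definition weighted_ergodic :: "('q, 'x, 'y) hmm \<Rightarrow> 'q \<Rightarrow> ('x \<times> 'y \<Rightarrow> real) \<Rightarrow> bool" where
  "weighted_ergodic H \<theta> w \<longleftrightarrow>
     (\<exists>\<nu>. sets \<nu> = sets (joint H) \<and> stationary (hmm_kernel H \<theta>) \<nu> \<and> integrable \<nu> w \<and>
        (\<forall>\<^sub>F n in sequentially. \<forall>z\<in>space (joint H). integrable (hmm_law_from H \<theta> z) (\<lambda>\<omega>. w (\<omega> n))) \<and>
        (\<lambda>n. SUP z\<in>space (joint H).
               SUP h\<in>{h \<in> borel_measurable (joint H). \<forall>z'\<in>space (joint H). \<bar>h z'\<bar> \<le> w z'}.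
                 ereal (\<bar>(\<integral>\<omega>. h (\<omega> n) \<partial>hmm_law_from H \<theta> z) - (\<integral>z'. h z' \<partial>\<nu>)\<bar> / w z))
          \<longlonglongrightarrow> 0)"

subsection \<open>The conditions\<close>

definition emit_sup :: "('q, 'x, 'y) hmm \<Rightarrow> 'q \<Rightarrow> 'x set \<Rightarrow> 'y \<Rightarrow> 'y \<Rightarrow> ennreal" where
  "emit_sup H \<theta> A y0 y1 = (SUP x\<in>A. ennreal (emit_dens H \<theta> x y0 y1))"

definition f_tilde :: "('q, 'x, 'y) hmm \<Rightarrow> 'q \<Rightarrow> 'y \<Rightarrow> 'y \<Rightarrow> ennreal" where
  "f_tilde H \<theta> y0 y1 =
     (SUP x0\<in>space (Qx H). \<integral>\<^sup>+x. ennreal (trans_dens H \<theta> x0 x) * ennreal (emit_dens H \<theta> x y0 y1) \<partial>Qx H)"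

text \<open>
  Finiteness of \<open>p\<^sub>\<theta>\<close> is built into its type. As suprema over uncountable sets, \<^const>\<open>emit_sup\<close> and
  \<^const>\<open>f_tilde\<close> need not be measurable; that they are is implicit in taking expectations of them.
\<close>

definition C1 :: "('q::euclidean_space, 'x, 'y::euclidean_space) hmm \<Rightarrow> 'q \<Rightarrow> bool" where
  "C1 H \<theta> \<longleftrightarrow>
     aperiodic_chain H \<theta> \<and> irreducible_chain H \<theta> \<and>
     (\<exists>w. w \<in> borel_measurable (joint H) \<and> (\<forall>z\<in>space (joint H). 1 \<le> w z) \<and>
        weighted_ergodic H \<theta> w \<and>
        (\<exists>p\<ge>1. (SUP z\<in>space (joint H).
            (\<integral>\<^sup>+\<omega>. ennreal (w (\<omega> p)) \<partial>hmm_law_from H \<theta> z) / ennreal (w z)) < \<infinity>) \<and>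
        (\<forall>y0. f_tilde H \<theta> y0 \<in> borel_measurable borel) \<and>
        (\<exists>p\<ge>1. (SUP z\<in>space (joint H).
            expect (hmm_law_from H \<theta> z)
              (\<lambda>\<omega>. elog ((f_tilde H \<theta> (snd z) (snd (\<omega> 1))) ^ p * ennreal (w (\<omega> p) / w z)))) < 0) \<and>
        (SUP z\<in>space (joint H).
            \<integral>\<^sup>+\<omega>. f_tilde H \<theta> (snd z) (snd (\<omega> 1)) * ennreal (w (\<omega> 1) / w z) \<partial>hmm_law_from H \<theta> z) < \<infinity>) \<and>
     (\<forall>x0\<in>space (Qx H). \<forall>x1\<in>space (Qx H). 0 < trans_dens H \<theta> x0 x1) \<and>
     (\<forall>y0 y1. 0 < emit_sup H \<theta> (space (Qx H)) y0 y1 \<and> emit_sup H \<theta> (space (Qx H)) y0 y1 < \<infinity>) \<and>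
     (\<exists>A. disjoint_family_on A {1..} \<and> (\<Union>n\<in>{1..}. A n) = space (Qx H) \<and>
        (\<forall>n\<ge>1. A n \<in> sets (Qx H) \<and> 0 < emeasure (Qx H) (A n) \<and> emeasure (Qx H) (A n) < \<infinity>) \<and>
        (\<forall>n\<ge>1. \<forall>y0. emit_sup H \<theta> (A n) y0 \<in> borel_measurable borel) \<and>
        (\<forall>y0. (\<integral>\<^sup>+\<omega>. (\<Sum>n. ennreal ((1/2) ^ Suc n) * emit_sup H \<theta> (A (Suc n)) y0 (snd (\<omega> 1)))
                 \<partial>hmm_law H \<theta>) < \<infinity>))"

definition nbhd :: "('q::euclidean_space, 'x, 'y) hmm \<Rightarrow> real \<Rightarrow> 'q \<Rightarrow> 'q set" where
  "nbhd H \<delta> \<theta>0 = {\<theta>\<in>Params H. norm (\<theta> - \<theta>0) < \<delta>}"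

text \<open>The condition C2 for \<open>r = 0\<close>.\<close>

definition C2 :: "('q::euclidean_space, 'x, 'y) hmm \<Rightarrow> real \<Rightarrow> 'q \<Rightarrow> bool" where
  "C2 H \<delta> \<theta>0 \<longleftrightarrow>
     \<theta>0 \<in> interior (Params H) \<and>
     (\<forall>x0\<in>space (Qx H). \<forall>x\<in>space (Qx H). continuous_on (nbhd H \<delta> \<theta>0) (\<lambda>\<theta>. trans_dens H \<theta> x0 x)) \<and>
     (\<forall>x0\<in>space (Qx H). continuous_on (nbhd H \<delta> \<theta>0) (\<lambda>\<theta>. stat_dens H \<theta> x0))"

subsection \<open>Likelihoods and Kullback-Leibler divergence\<close>

definition likelihood :: "('q, 'x, 'y) hmm \<Rightarrow> 'q \<Rightarrow> nat \<Rightarrow> (nat \<Rightarrow> 'y) \<Rightarrow> ennreal" where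
  "likelihood H \<theta> n y =
     (\<integral>\<^sup>+x. ennreal (stat_dens H \<theta> (x 0) * emit0_dens H \<theta> (x 0) (y 0) *
             (\<Prod>t=1..n. trans_dens H \<theta> (x (t - 1)) (x t) * emit_dens H \<theta> (x t) (y (t - 1)) (y t)))
        \<partial>PiM {..n} (\<lambda>_. Qx H))"

text \<open>
  A likelihood of the component \<open>c Y\<^sub>0, \<dots>, c Y\<^sub>n\<close> is a density of its law under \<open>P\<^sup>\<theta>\<close> with respect to
  the product of a \<open>\<sigma>\<close>-finite reference measure \<open>R\<close>.
\<close>

definition component_likelihood :: "('q, 'x, 'y) hmm \<Rightarrow> 'q \<Rightarrow> ('y \<Rightarrow> 'a::euclidean_space) \<Rightarrow>
    'a measure \<Rightarrow> (nat \<Rightarrow> (nat \<Rightarrow> 'a) \<Rightarrow> ennreal) \<Rightarrow> bool" where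
  "component_likelihood H \<theta> c R l \<longleftrightarrow>
     sigma_finite_measure R \<and> sets R = sets borel \<and>
     (\<forall>n. distributed (hmm_law H \<theta>) (PiM {..n} (\<lambda>_. R)) (\<lambda>\<omega>. \<lambda>i\<in>{..n}. c (snd (\<omega> i))) (l n))"

definition log_ratio_limit ::
    "'w measure \<Rightarrow> (nat \<Rightarrow> 'w \<Rightarrow> ennreal) \<Rightarrow> (nat \<Rightarrow> 'w \<Rightarrow> ennreal) \<Rightarrow> ereal \<Rightarrow> bool" where
  "log_ratio_limit M l1 l0 K \<longleftrightarrow>
     (AE \<omega> in M. (\<lambda>n. (elog (l1 n \<omega>) - elog (l0 n \<omega>)) / ereal (real n)) \<longlonglongrightarrow> K)"

text \<open>\<open>K\<close> is the constant \<open>K(\<theta>\<^sub>1, \<theta>\<^sub>0)\<close>; the limit is allowed to be infinite.\<close>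

definition hmm_KL :: "('q, 'x, 'y) hmm \<Rightarrow> 'q \<Rightarrow> 'q \<Rightarrow> ereal \<Rightarrow> bool" where
  "hmm_KL H \<theta>1 \<theta>0 K \<longleftrightarrow>
     log_ratio_limit (hmm_law H \<theta>1) (\<lambda>n \<omega>. likelihood H \<theta>1 n (\<lambda>i. snd (\<omega> i)))
                              (\<lambda>n \<omega>. likelihood H \<theta>0 n (\<lambda>i. snd (\<omega> i))) K"

definition component_hmm_KL :: "('q, 'x, 'y) hmm \<Rightarrow> ('y \<Rightarrow> 'a) \<Rightarrow>
    ('q \<Rightarrow> nat \<Rightarrow> (nat \<Rightarrow> 'a) \<Rightarrow> ennreal) \<Rightarrow> 'q \<Rightarrow> 'q \<Rightarrow> ereal \<Rightarrow> bool" where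
  "component_hmm_KL H c l \<theta>1 \<theta>0 K \<longleftrightarrow>
     log_ratio_limit (hmm_law H \<theta>1) (\<lambda>n \<omega>. l \<theta>1 n (\<lambda>i\<in>{..n}. c (snd (\<omega> i))))
                              (\<lambda>n \<omega>. l \<theta>0 n (\<lambda>i\<in>{..n}. c (snd (\<omega> i)))) K"

text \<open>\<open>y \<leftrightarrow> (c1 y, c2 y)\<close> identifies the observation space with a product of Euclidean spaces.\<close>

definition splitting :: "('y::euclidean_space \<Rightarrow> 'a::euclidean_space) \<Rightarrow>
    ('y \<Rightarrow> 'b::euclidean_space) \<Rightarrow> bool" where
  "splitting c1 c2 \<longleftrightarrow> linear c1 \<and> linear c2 \<and> bij (\<lambda>y. (c1 y, c2 y))"

end

theory Submission
  imports Defs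
begin

text \<open>
  For each \<open>n\<close> the likelihoods are densities, under the two parameters, of the law of the
  observations with respect to one reference measure. Hence the likelihood ratio \<open>L\<^sub>0 / L\<^sub>1\<close> has
  \<open>P\<^sup>\<theta>\<close>-expectation at most \<open>1\<close> for \<open>\<theta> = \<theta>\<^sub>1\<close>, so \<open>\<Sum>\<^sub>n exp (-c n) L\<^sub>0 / L\<^sub>1\<close> is almost surely finite
  for every \<open>c > 0\<close>, and eventually \<open>(log L\<^sub>1 - log L\<^sub>0) / n \<ge> -c\<close>. The same argument applies to the
  components; as \<open>K\<^sub>1\<close> and \<open>K\<^sub>2\<close> are thus not \<open>-\<infinity>\<close>, the limits of the two summands may be added.

  The likelihood is the density of \<open>Y\<^sub>0, \<dots>, Y\<^sub>n\<close> because the Ionescu-Tulcea measure built from kernels with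
  densities has the product of these densities as its finite-dimensional density, and the hidden
  states are then integrated out by Fubini's theorem.
\<close>

subsection \<open>Likelihood ratios\<close>

lemma elog_ennreal: "elog (ennreal r) = (if r \<le> 0 then -\<infinity> else ereal (ln r))"
  by (simp add: elog_def ennreal_eq_0_iff)

text \<open>Finiteness excludes the factors 0 and \<infinity>, for which the left side is
  -\<infinity> and the right side \<infinity>. If a finite factor vanishes, both sides are
  -\<infinity>.\<close>

lemma elog_mult:
  assumes "a \<noteq> \<infinity>" "b \<noteq> \<infinity>"
  shows "elog (a * b) = elog a + elog b"
proof -
  obtain r s where "a = ennreal r" "b = ennreal s" "0 \<le> r" "0 \<le> s"
    using assms by (cases a; cases b) auto
  then show ?thesis
    by (cases "r = 0 \<or> s = 0") (auto simp: elog_ennreal ln_mult mult_le_0_iff simp flip: ennreal_mult)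
qed

lemma elog_less_PInf: "a \<noteq> \<infinity> \<Longrightarrow> elog a < \<infinity>"
  by (simp add: elog_def)

text \<open>The logarithms of \<open>a1\<close> and \<open>b1\<close> are real, so a difference of
  the form \<infinity> - \<infinity> cannot occur. A vanishing \<open>a0\<close> or
  \<open>b0\<close> makes both sides \<infinity>.\<close>

lemma elog_ratio_add:
  assumes "a1 \<noteq> 0" "a1 \<noteq> \<infinity>" "b1 \<noteq> 0" "b1 \<noteq> \<infinity>" "a0 \<noteq> \<infinity>" "b0 \<noteq> \<infinity>" "0 < n"
  shows "(elog (a1 * b1) - elog (a0 * b0)) / ereal (real n)
       = (elog a1 - elog a0) / ereal (real n) + (elog b1 - elog b0) / ereal (real n)"
proof -
  obtain r s where "elog a1 = ereal r" "elog b1 = ereal s"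
    using assms by (cases a1; cases b1) (auto simp: elog_ennreal ennreal_eq_0_iff not_le)
  moreover have "elog a0 \<noteq> \<infinity>" "elog b0 \<noteq> \<infinity>"
    using assms elog_less_PInf by auto
  ultimately show ?thesis
    using assms
    by (cases "elog a0"; cases "elog b0") (auto simp: elog_mult field_simps ereal_divide)
qed

text \<open>This is the logarithm of the assumed bound, divided by \<open>n\<close>. When
  \<open>l0\<close> vanishes, the quotient on the right is \<infinity>.\<close>

lemma ratio_ge_of_le_exp:
  assumes l1: "l1 \<noteq> 0" "l1 \<noteq> \<infinity>" and n: "0 < n"
    and le: "ennreal (exp (- c * real n)) * (l0 / l1) \<le> 1"
  shows "ereal (- c) \<le> (elog l1 - elog l0) / ereal (real n)"
proof -
  obtain r where r: "l1 = ennreal r" "0 < r"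
    using l1 by (cases l1) (auto simp: less_le)
  \<comment> \<open>As \<open>l1\<close> is finite and the exponential positive, an infinite
    \<open>l0\<close> would make the product infinite.\<close>
  have "l0 \<noteq> \<infinity>"
    using le r by (auto simp: ennreal_top_divide ennreal_mult_top top_unique)
  then obtain s where s: "l0 = ennreal s" "0 \<le> s"
    by (cases l0) auto
  show ?thesis
  proof (cases "s = 0")
    case True
    then show ?thesis
      using r s n by (simp add: elog_def)
  next
    case False
    have "ennreal (exp (- c * real n) * (s / r)) \<le> 1"
      using le r s by (simp add: divide_ennreal flip: ennreal_mult)
    then have "exp (- c * real n) * (s / r) \<le> 1"
      by simp
    then have "ln (exp (- c * real n) * (s / r)) \<le> 0"
      using False r s by (subst ln_le_zero_iff) auto
    then have "- c * real n + (ln s - ln r) \<le> 0"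
      using False r s by (simp add: ln_mult ln_div)
    then show ?thesis
      using r s False n by (auto simp: elog_def ereal_divide field_simps)
  qed
qed

section \<open>Almost sure properties of densities and their ratios\<close>

lemma nn_integral_distributed_density:
  assumes "prob_space M" and X: "distributed M N X f"
  shows "(\<integral>\<^sup>+y. f y \<partial>N) = 1"
proof -
  interpret prob_space M by fact
  show ?thesis
    using distributed_nn_integral[OF X, of "\<lambda>_. 1"] emeasure_space_1
    by simp
qed

lemma distributed_AE_iff:
  assumes X: "distributed M N X f" and [measurable]: "Measurable.pred N P"
  shows "(AE \<omega> in M. P (X \<omega>)) \<longleftrightarrow> (AE y in N. 0 < f y \<longrightarrow> P y)"
proof -
  note [measurable] = distributed_measurable[OF X] distributed_borel_measurable[OF X]
  have "(AE \<omega> in M. P (X \<omega>)) \<longleftrightarrow> (AE y in distr M N X. P y)"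
    by (subst AE_distr_iff) auto
  also have "\<dots> \<longleftrightarrow> (AE y in N. 0 < f y \<longrightarrow> P y)"
    unfolding distributed_distr_eq_density[OF X] by (rule AE_density) simp
  finally show ?thesis .
qed

text \<open>Having integral 1, \<open>f0\<close> is finite almost everywhere for \<open>N\<close>,
  and the law of \<open>X\<close> under the other measure \<open>M\<close> is absolutely continuous
  with respect to \<open>N\<close>. This controls the likelihood at one parameter under the law of
  another.\<close>

lemma distributed_AE_finite:
  assumes "prob_space M0" and X0: "distributed M0 N X0 f0" and X: "distributed M N X f"
  shows "AE \<omega> in M. f0 (X \<omega>) \<noteq> \<infinity>"
proof -
  note [measurable] = distributed_borel_measurable[OF X0]
  have "AE y in N. f0 y \<noteq> \<infinity>"
    using nn_integral_distributed_density[OF assms(1,2)]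
    by (intro nn_integral_PInf_AE) auto
  then show ?thesis
    by (subst distributed_AE_iff[OF X]) auto
qed

text \<open>The law of \<open>X\<close> gives no mass to the zero set of its own density.\<close>

lemma distributed_AE_nonzero:
  assumes X: "distributed M N X f"
  shows "AE \<omega> in M. f (X \<omega>) \<noteq> 0"
proof -
  note [measurable] = distributed_borel_measurable[OF X]
  show ?thesis
    by (subst distributed_AE_iff[OF X]) auto
qed

text \<open>Integrating against \<open>f1\<close> cancels the denominator. Only an inequality
  results, since \<open>f0\<close> may have mass where \<open>f1\<close> vanishes.\<close>

lemma nn_integral_likelihood_ratio_le_1:
  assumes "prob_space M0" and X0: "distributed M0 N X f0" and X1: "distributed M1 N X f1"
  shows "(\<integral>\<^sup>+\<omega>. f0 (X \<omega>) / f1 (X \<omega>) \<partial>M1) \<le> 1"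
proof -
  note [measurable] = distributed_borel_measurable[OF X1] distributed_borel_measurable[OF X0]
  have "(\<integral>\<^sup>+\<omega>. f0 (X \<omega>) / f1 (X \<omega>) \<partial>M1) = (\<integral>\<^sup>+y. f1 y * (f0 y / f1 y) \<partial>N)"
    by (rule distributed_nn_integral[OF X1, symmetric]) simp
  also have "\<dots> \<le> (\<integral>\<^sup>+y. f0 y \<partial>N)"
  proof (rule nn_integral_mono)
    fix y
    show "f1 y * (f0 y / f1 y) \<le> f0 y"
    \<comment> \<open>In both exceptional cases the conventions of \<open>ennreal\<close> make the
      left side 0.\<close>
    proof (cases "f1 y = 0 \<or> f1 y = \<top>")
      case False
      then have "f1 y * (f0 y / f1 y) = f0 y"
        by (metis ennreal_mult_divide_eq ennreal_times_divide mult.commute infinity_ennreal_def)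
      then show ?thesis by simp
    qed auto
  qed
  also have "\<dots> = 1"
    by (rule nn_integral_distributed_density[OF assms(1,2)])
  finally show ?thesis .
qed

text \<open>The random variables \<open>X n\<close> and reference measures \<open>N n\<close> are
  arbitrary, so that the lemma covers the full observations as well as each component.\<close>

lemma log_ratio_limit_nonneg:
  assumes M1: "prob_space M1" and M0: "prob_space M0"
    and X1: "\<And>n. distributed M1 (N n) (X n) (f1 n)"
    and X0: "\<And>n. distributed M0 (N n) (X n) (f0 n)"
    and lim: "log_ratio_limit M1 (\<lambda>n \<omega>. f1 n (X n \<omega>)) (\<lambda>n \<omega>. f0 n (X n \<omega>)) K"
  shows "0 \<le> K"
proof (rule ccontr)
  interpret prob_space M1 by fact
  note [measurable] = distributed_measurable[OF X1] distributed_borel_measurable[OF X1]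
    distributed_borel_measurable[OF X0]
  assume "\<not> 0 \<le> K"
  then obtain c' where c': "K < ereal c'" "ereal c' < 0"
    using ereal_dense2[of K 0] by (auto simp: not_le)
  define c where "c = - c'"
  have c: "0 < c" "K < ereal (- c)"
    using c' by (auto simp: c_def)
  \<comment> \<open>Each \<open>g n\<close> has expectation at most
    \<open>exp (- c * real n)\<close>, the general term of a convergent geometric series.\<close>
  define g where "g n \<omega> = ennreal (exp (- c * real n)) * (f0 n (X n \<omega>) / f1 n (X n \<omega>))" for n \<omega>
  have [measurable]: "g n \<in> borel_measurable M1" for n
    unfolding g_def by measurable
  have geo: "summable (\<lambda>n. exp (- c * real n))"
  proof -
    have "summable (\<lambda>n. exp (- c) ^ n)"
      using c by (intro summable_geometric) auto
    then show ?thesis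
      by (simp add: exp_of_nat_mult[symmetric] mult.commute)
  qed
  have "(\<integral>\<^sup>+\<omega>. (\<Sum>n. g n \<omega>) \<partial>M1) = (\<Sum>n. \<integral>\<^sup>+\<omega>. g n \<omega> \<partial>M1)"
    by (rule nn_integral_suminf) simp
  also have "\<dots> \<le> (\<Sum>n. ennreal (exp (- c * real n)))"
  proof (intro suminf_le summableI)
    fix n
    have "(\<integral>\<^sup>+\<omega>. g n \<omega> \<partial>M1) \<le> ennreal (exp (- c * real n)) * 1"
      unfolding g_def
      by (subst nn_integral_cmult)
         (measurable, intro mult_left_mono nn_integral_likelihood_ratio_le_1[OF M0 X0 X1], simp)
    then show "(\<integral>\<^sup>+\<omega>. g n \<omega> \<partial>M1) \<le> ennreal (exp (- c * real n))"
      by simp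
  qed
  also have "\<dots> < \<infinity>"
    using geo by (simp add: suminf_ennreal2)
  finally have "AE \<omega> in M1. (\<Sum>n. g n \<omega>) \<noteq> \<infinity>"
    by (intro nn_integral_PInf_AE) auto
  moreover have "AE \<omega> in M1. \<forall>n. f1 n (X n \<omega>) \<noteq> 0 \<and> f1 n (X n \<omega>) \<noteq> \<infinity>"
    using distributed_AE_nonzero[OF X1] distributed_AE_finite[OF M1 X1 X1]
    by (simp add: AE_all_countable)
  ultimately have "AE \<omega> in M1. False"
    using lim[unfolded log_ratio_limit_def]
  proof eventually_elim
    case (elim \<omega>)
    \<comment> \<open>Finite terms can be moved from \<open>ennreal\<close> to the reals, where the
      terms of a convergent series tend to 0 and are therefore eventually below 1.\<close>
    have "g n \<omega> \<noteq> \<top>" for n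
    proof
      assume "g n \<omega> = \<top>"
      moreover have "g n \<omega> \<le> (\<Sum>n. g n \<omega>)"
        using sum_le_suminf[of "\<lambda>n. g n \<omega>" "{n}"] by simp
      ultimately show False
        using elim(1) by (simp add: top_unique)
    qed
    then have *: "g n \<omega> = ennreal (enn2real (g n \<omega>))" for n
      by (simp add: less_top)
    have "summable (\<lambda>n. enn2real (g n \<omega>))"
      using elim(1) * by (intro summable_suminf_not_top) (auto simp flip: *)
    then have "eventually (\<lambda>n. enn2real (g n \<omega>) < 1) sequentially"
      by (rule order_tendstoD(2)[OF summable_LIMSEQ_zero]) simp
    then have "eventually (\<lambda>n. ereal (- c) \<le>
        (elog (f1 n (X n \<omega>)) - elog (f0 n (X n \<omega>))) / ereal (real n)) sequentially"
      \<comment> \<open>At \<open>n = 0\<close> the quotient would divide by zero.\<close>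
      using eventually_gt_at_top[of 0]
    proof eventually_elim
      case (elim n)
      have "g n \<omega> \<le> 1"
        using elim(1) by (subst *) simp
      then show ?case
        using \<open>\<forall>n. f1 n (X n \<omega>) \<noteq> 0 \<and> f1 n (X n \<omega>) \<noteq> \<infinity>\<close> elim(2)
        unfolding g_def by (intro ratio_ge_of_le_exp) auto
    qed
    then have "ereal (- c) \<le> K"
      using elim(3) by (intro tendsto_lowerbound[OF elim(3)]) auto
    then show False
      using c by simp
  qed
  \<comment> \<open>A probability space is not a null set, so \<open>False\<close> cannot hold
    almost everywhere.\<close>
  then show False
    by simp
qed

subsection \<open>Densities of Ionescu-Tulcea measures\<close>

text \<open>It suffices to test the mass of each fixed set, and this mass is an integral depending
  measurably on the parameter \<open>a\<close>.\<close>

lemma measurable_density_kernel: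
  assumes "sigma_finite_measure N"
    and k[measurable]: "(\<lambda>(a, x). k a x) \<in> borel_measurable (A \<Otimes>\<^sub>M N)"
    and one: "\<And>a. a \<in> space A \<Longrightarrow> (\<integral>\<^sup>+x. k a x \<partial>N) = 1"
  shows "(\<lambda>a. density N (k a)) \<in> measurable A (subprob_algebra N)"
proof (rule measurable_subprob_algebra)
  fix a assume a[measurable]: "a \<in> space A"
  have "k a \<in> borel_measurable N"
    using measurable_compose[OF measurable_Pair1'[OF a] k] by simp
  then show "subprob_space (density N (k a))"
    by (intro prob_space_imp_subprob_space prob_spaceI)
       (simp add: emeasure_density one[OF a] cong: nn_integral_cong)
next
  interpret sigma_finite_measure N by fact
  fix B assume [measurable]: "B \<in> sets N"
  have "(\<lambda>a. \<integral>\<^sup>+x. k a x * indicator B x \<partial>N) \<in> borel_measurable A"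
    by measurable
  also have "?this \<longleftrightarrow> (\<lambda>a. emeasure (density N (k a)) B) \<in> borel_measurable A"
  proof (rule measurable_cong)
    fix a assume a: "a \<in> space A"
    have "k a \<in> borel_measurable N"
      using measurable_compose[OF measurable_Pair1'[OF a] k] by simp
    then show "(\<integral>\<^sup>+x. k a x * indicator B x \<partial>N) = emeasure (density N (k a)) B"
      by (simp add: emeasure_density)
  qed
  finally show "(\<lambda>a. emeasure (density N (k a)) B) \<in> borel_measurable A" .
qed simp

lemma Ionescu_Tulcea_density:
  assumes "\<And>i. sigma_finite_measure (M i)"
    and "\<And>i. (\<lambda>(\<omega>, x). k i \<omega> x) \<in> borel_measurable (PiM {0..<i} M \<Otimes>\<^sub>M M i)"
    and "\<And>i \<omega>. \<omega> \<in> space (PiM {0..<i} M) \<Longrightarrow> (\<integral>\<^sup>+x. k i \<omega> x \<partial>M i) = 1"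
  shows "Ionescu_Tulcea (\<lambda>i \<omega>. density (M i) (k i \<omega>)) M"
proof (rule Ionescu_Tulcea.intro)
  fix i \<omega> assume \<omega>: "\<omega> \<in> space (PiM {0..<i} M)"
  have "k i \<omega> \<in> borel_measurable (M i)"
    using measurable_compose[OF measurable_Pair1'[OF \<omega>] assms(2)] by simp
  then show "prob_space (density (M i) (k i \<omega>))"
    by (intro prob_spaceI) (simp add: emeasure_density assms(3)[OF \<omega>] cong: nn_integral_cong)
qed (rule measurable_density_kernel[OF assms])

text \<open>By induction, each stage multiplies the density by that of the kernel for the new
  coordinate. The constant \<open>undefined\<close> function is the empty history; the restrictions
  are there because the kernel \<open>i\<close> expects a history indexed by
  \<open>{0..<i}\<close>.\<close>

lemma Ionescu_Tulcea_C_density: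
  assumes sf: "\<And>i. sigma_finite_measure (M i)"
    and k: "\<And>i. (\<lambda>(\<omega>, x). k i \<omega> x) \<in> borel_measurable (PiM {0..<i} M \<Otimes>\<^sub>M M i)"
    and one: "\<And>i \<omega>. \<omega> \<in> space (PiM {0..<i} M) \<Longrightarrow> (\<integral>\<^sup>+x. k i \<omega> x \<partial>M i) = 1"
  shows "Ionescu_Tulcea.C (\<lambda>i \<omega>. density (M i) (k i \<omega>)) M 0 n (\<lambda>_. undefined)
       = density (PiM {0..<n} M) (\<lambda>\<omega>. \<Prod>i<n. k i (restrict \<omega> {0..<i}) (\<omega> i))"
proof -
  interpret IT: Ionescu_Tulcea "\<lambda>i \<omega>. density (M i) (k i \<omega>)" M
    by (rule Ionescu_Tulcea_density[OF sf k one])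
  interpret S: product_sigma_finite M
    by (rule product_sigma_finite.intro) (rule sf)
  have k'[measurable]: "(\<lambda>\<omega>. k i (restrict \<omega> {0..<i}) (\<omega> i)) \<in> borel_measurable (PiM J M)"
    if "insert i {0..<i} \<subseteq> J" for i J
  proof -
    have "(\<lambda>\<omega>. (restrict \<omega> {0..<i}, \<omega> i)) \<in> measurable (PiM J M) (PiM {0..<i} M \<Otimes>\<^sub>M M i)"
      using that by (intro measurable_Pair measurable_restrict_subset measurable_component_singleton) auto
    from measurable_compose[OF this k] show ?thesis by simp
  qed
  show ?thesis
  proof (induction n)
    \<comment> \<open>Both sides are the unit mass on the one-point space of the empty
      product.\<close>
    case 0
    show ?case
      by (auto simp: PiM_empty intro!: measure_eqI dest!: subset_singletonD)
         (auto simp: emeasure_density)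
  next
    case (Suc n)
    let ?p = "\<lambda>n \<omega>. \<Prod>i<n. k i (restrict \<omega> {0..<i}) (\<omega> i)"
    let ?P = "\<lambda>n. PiM {0..<n} M"
    have p[measurable]: "?p n \<in> borel_measurable (?P m)" if "n \<le> m" for n m
      using that by (intro borel_measurable_prod_ennreal k') auto
    show ?case
    proof (rule measure_eqI)
      show "sets (IT.C 0 (Suc n) (\<lambda>_. undefined)) = sets (density (?P (Suc n)) (?p (Suc n)))"
        by (subst IT.sets_C) auto
      fix A assume "A \<in> sets (IT.C 0 (Suc n) (\<lambda>_. undefined))"
      then have A[measurable]: "A \<in> sets (?P (Suc n))"
        by (subst (asm) IT.sets_C) auto
      have k_meas: "k n \<omega> \<in> borel_measurable (M n)" if "\<omega> \<in> space (?P n)" for \<omega>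
        using measurable_compose[OF measurable_Pair1'[OF that] k] by simp
      have upd[measurable]: "fun_upd \<omega> n \<in> measurable (M n) (?P (Suc n))" if "\<omega> \<in> space (?P n)" for \<omega>
        using that by (intro measurable_fun_upd[where J="{0..<n}"]) auto
      \<comment> \<open>\<open>IT.eP n\<close> draws coordinate \<open>n\<close> from the kernel and
        appends it to the history.\<close>
      have eP: "emeasure (IT.eP n \<omega>) A = (\<integral>\<^sup>+x. k n \<omega> x * indicator A (fun_upd \<omega> n x) \<partial>M n)"
        if \<omega>: "\<omega> \<in> space (?P n)" for \<omega>
      proof -
        have "emeasure (IT.eP n \<omega>) A = (\<integral>\<^sup>+x. indicator A x \<partial>IT.eP n \<omega>)"
          using \<omega> by (simp add: IT.sets_eP)
        also have "\<dots> = (\<integral>\<^sup>+x. indicator A (fun_upd \<omega> n x) \<partial>density (M n) (k n \<omega>))"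
          using \<omega> by (intro IT.nn_integral_eP) auto
        also have "\<dots> = (\<integral>\<^sup>+x. k n \<omega> x * indicator A (fun_upd \<omega> n x) \<partial>M n)"
          using k_meas[OF \<omega>] upd[OF \<omega>] by (intro nn_integral_density) auto
        finally show ?thesis .
      qed
      have [measurable]: "(\<lambda>\<omega>. emeasure (IT.eP n \<omega>) A) \<in> borel_measurable (?P n)"
        using IT.measurable_eP A by (rule measurable_emeasure_kernel)
      have "emeasure (IT.C 0 (Suc n) (\<lambda>_. undefined)) A
          = (\<integral>\<^sup>+\<omega>. emeasure (IT.eP n \<omega>) A \<partial>IT.C 0 n (\<lambda>_. undefined))"
        unfolding IT.C.simps
        by (subst emeasure_bind[where N="?P (Suc n)"])
           (auto simp: IT.space_C measurable_cong_sets[OF IT.sets_C refl] space_PiM_empty)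
      also have "\<dots> = (\<integral>\<^sup>+\<omega>. ?p n \<omega> * emeasure (IT.eP n \<omega>) A \<partial>?P n)"
        unfolding Suc.IH by (intro nn_integral_density) auto
      also have "\<dots> = (\<integral>\<^sup>+\<omega>. (\<integral>\<^sup>+x. ?p n \<omega> * (k n \<omega> x * indicator A (fun_upd \<omega> n x)) \<partial>M n) \<partial>?P n)"
        using k_meas upd
        by (intro nn_integral_cong) (simp add: eP nn_integral_cmult)
      also have "\<dots> = (\<integral>\<^sup>+\<omega>. (\<integral>\<^sup>+x. ?p (Suc n) (fun_upd \<omega> n x) * indicator A (fun_upd \<omega> n x) \<partial>M n) \<partial>?P n)"
      proof (intro nn_integral_cong)
        fix \<omega> x assume \<omega>: "\<omega> \<in> space (?P n)"
        \<comment> \<open>Setting coordinate \<open>n\<close> leaves the histories seen by the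
          kernels \<open>0\<close> to \<open>n\<close> unchanged, so only the new last factor
          involves \<open>x\<close>.\<close>
        have "restrict (fun_upd \<omega> n x) {0..<i} = restrict \<omega> {0..<i}" if "i \<le> n" for i
          using that by (auto simp: restrict_def)
        moreover have "restrict \<omega> {0..<n} = \<omega>"
          using \<omega> by (simp add: space_PiM PiE_restrict)
        ultimately show "?p n \<omega> * (k n \<omega> x * indicator A (fun_upd \<omega> n x))
            = ?p (Suc n) (fun_upd \<omega> n x) * indicator A (fun_upd \<omega> n x)"
          by (simp add: ac_simps)
      qed
      also have "\<dots> = (\<integral>\<^sup>+\<omega>. ?p (Suc n) \<omega> * indicator A \<omega> \<partial>?P (Suc n))"
        unfolding atLeast0_lessThan_Suc
        by (subst S.product_nn_integral_insert) (auto simp flip: atLeast0_lessThan_Suc simp del: prod.lessThan_Suc)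
      also have "\<dots> = emeasure (density (?P (Suc n)) (?p (Suc n))) A"
        by (subst emeasure_density) (auto simp del: prod.lessThan_Suc)
      finally show "emeasure (IT.C 0 (Suc n) (\<lambda>_. undefined)) A
          = emeasure (density (?P (Suc n)) (?p (Suc n))) A" .
    qed
  qed
qed

text \<open>The marginal on a finite index set \<open>J\<close> is the projection of the stage
  \<open>up_to J\<close>. For \<open>J = {..n}\<close> this is the stage \<open>Suc n\<close>, and
  the projection is the identity there.\<close>

lemma (in Ionescu_Tulcea) distr_lim_atMost:
  "distr PF.lim (PiM {..n} M) (\<lambda>\<omega>. restrict \<omega> {..n}) = C 0 (Suc n) (\<lambda>_. undefined)"
proof -
  have "up_to {..n} = Suc n"
    by (intro antisym) (auto simp: up_to_iff Suc_le_eq up_to_less)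
  moreover have "distr (C 0 (Suc n) (\<lambda>_. undefined)) (PiM {0..<0 + Suc n} M) (\<lambda>f. restrict f {0..<0 + Suc n})
      = C 0 (Suc n) (\<lambda>_. undefined)"
    by (rule distr_C[symmetric]) (auto simp: space_PiM_empty)
  ultimately show ?thesis
    by (simp add: distr_lim CI_def atLeast0AtMost atLeastLessThanSuc_atLeastAtMost del: C.simps)
qed

text \<open>A product measure is determined by its values on boxes, and these agree by Fubini's
  theorem. The lemma serves to separate the hidden states from the observations.\<close>

lemma PiM_pair_measure:
  assumes "finite I" and A: "\<And>i. sigma_finite_measure (A i)" and B: "\<And>i. sigma_finite_measure (B i)"
  shows "PiM I (\<lambda>i. A i \<Otimes>\<^sub>M B i)
    = distr (PiM I A \<Otimes>\<^sub>M PiM I B) (PiM I (\<lambda>i. A i \<Otimes>\<^sub>M B i)) (\<lambda>(x, y). \<lambda>i\<in>I. (x i, y i))"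
    (is "?R = ?L")
proof -
  interpret A: product_sigma_finite A by (rule product_sigma_finite.intro) (rule A)
  interpret B: product_sigma_finite B by (rule product_sigma_finite.intro) (rule B)
  have AB: "sigma_finite_measure (A i \<Otimes>\<^sub>M B i)" for i
    by (intro sigma_finite_pair_measure A B)
  interpret AB: product_sigma_finite "\<lambda>i. A i \<Otimes>\<^sub>M B i" by (rule product_sigma_finite.intro) (rule AB)
  interpret IA: sigma_finite_measure "PiM I A" by (rule A.sigma_finite) fact
  interpret IB: sigma_finite_measure "PiM I B" by (rule B.sigma_finite) fact
  interpret P: pair_sigma_finite "PiM I A" "PiM I B" ..
  have [measurable]: "(\<lambda>(x, y). \<lambda>i\<in>I. (x i, y i)) \<in> measurable (PiM I A \<Otimes>\<^sub>M PiM I B) (PiM I (\<lambda>i. A i \<Otimes>\<^sub>M B i))"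
    unfolding split_beta'
    by (intro measurable_restrict measurable_Pair measurable_compose[OF measurable_fst]
        measurable_compose[OF measurable_snd] measurable_component_singleton)
  have "?L = ?R"
  proof (rule AB.PiM_eqI[OF \<open>finite I\<close>])
    fix S assume S: "\<And>i. i \<in> I \<Longrightarrow> S i \<in> sets (A i \<Otimes>\<^sub>M B i)"
    note [measurable] = S \<open>finite I\<close>
    have ind: "indicator (Pi\<^sub>E I S) (\<lambda>i\<in>I. (x i, y i)) = (\<Prod>i\<in>I. indicator (S i) (x i, y i) :: ennreal)"
      for x y
    proof (cases "\<forall>i\<in>I. (x i, y i) \<in> S i")
      case False
      then show ?thesis
        using \<open>finite I\<close> by (subst prod_zero) (auto simp: indicator_def PiE_iff)
    qed (auto simp: indicator_def)
    have f: "(\<lambda>y. \<integral>\<^sup>+x. indicator (S i) (x, y) \<partial>A i) \<in> borel_measurable (B i)" if "i \<in> I" for i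
    proof -
      interpret P: pair_sigma_finite "B i" "A i"
        by (intro pair_sigma_finite.intro A B)
      have "(\<lambda>(y, x). indicator (S i) (x, y) :: ennreal) \<in> borel_measurable (B i \<Otimes>\<^sub>M A i)"
        using S[OF that] by measurable
      then show ?thesis
        by (rule sigma_finite_measure.borel_measurable_nn_integral[OF A])
    qed
    have sec: "(\<lambda>x. indicator (S i) (x, y)) \<in> borel_measurable (A i)"
      if "i \<in> I" "y \<in> space (B i)" for i y
      using S[OF that(1)] that(2) by measurable
    have "emeasure ?L (Pi\<^sub>E I S) = (\<integral>\<^sup>+z. indicator (Pi\<^sub>E I S) z \<partial>?L)"
      using S \<open>finite I\<close> by (intro nn_integral_indicator[symmetric]) (auto intro!: sets_PiM_I_finite)
    also have "\<dots> = (\<integral>\<^sup>+(x, y). (\<Prod>i\<in>I. indicator (S i) (x i, y i)) \<partial>(PiM I A \<Otimes>\<^sub>M PiM I B))"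
      using S \<open>finite I\<close> by (subst nn_integral_distr) (auto intro!: nn_integral_cong sets_PiM_I_finite simp: ind)
    also have "\<dots> = (\<integral>\<^sup>+y. (\<integral>\<^sup>+x. (\<Prod>i\<in>I. indicator (S i) (x i, y i)) \<partial>PiM I A) \<partial>PiM I B)"
    proof (subst P.nn_integral_snd[symmetric])
      have "(\<lambda>z. (fst z i, snd z i)) \<in> measurable (PiM I A \<Otimes>\<^sub>M PiM I B) (A i \<Otimes>\<^sub>M B i)" if "i \<in> I" for i
        using that by measurable
      then show "(\<lambda>(x, y). \<Prod>i\<in>I. indicator (S i) (x i, y i) :: ennreal) \<in> borel_measurable (PiM I A \<Otimes>\<^sub>M PiM I B)"
        using S by (auto simp: split_beta' intro!: borel_measurable_prod_ennreal
          measurable_compose[where N="A i \<Otimes>\<^sub>M B i" for i] borel_measurable_indicator)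
    qed simp
    \<comment> \<open>The sets \<open>S i\<close> need not be rectangles. For fixed
      \<open>y\<close>, however, the integrand is a product of functions of single coordinates of
      \<open>x\<close>; afterwards the same holds in \<open>y\<close>.\<close>
    also have "\<dots> = (\<integral>\<^sup>+y. (\<Prod>i\<in>I. (\<integral>\<^sup>+x. indicator (S i) (x, y i) \<partial>A i)) \<partial>PiM I B)"
      using \<open>finite I\<close> sec
      by (intro nn_integral_cong A.product_nn_integral_prod) (auto simp: space_PiM PiE_iff)
    also have "\<dots> = (\<Prod>i\<in>I. (\<integral>\<^sup>+y. (\<integral>\<^sup>+x. indicator (S i) (x, y) \<partial>A i) \<partial>B i))"
      using \<open>finite I\<close> f by (rule B.product_nn_integral_prod)
    also have "\<dots> = (\<Prod>i\<in>I. emeasure (A i \<Otimes>\<^sub>M B i) (S i))"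
    proof (rule prod.cong)
      fix i assume "i \<in> I"
      interpret P: pair_sigma_finite "A i" "B i"
        by (intro pair_sigma_finite.intro A B)
      show "(\<integral>\<^sup>+y. (\<integral>\<^sup>+x. indicator (S i) (x, y) \<partial>A i) \<partial>B i) = emeasure (A i \<Otimes>\<^sub>M B i) (S i)"
        using S[OF \<open>i \<in> I\<close>] by (subst P.nn_integral_snd) auto
    qed simp
    finally show "emeasure ?L (Pi\<^sub>E I S) = (\<Prod>i\<in>I. emeasure (A i \<Otimes>\<^sub>M B i) (S i))" .
  qed simp
  then show ?thesis ..
qed

subsection \<open>The likelihood as a density\<close>

text \<open>Reconciles likelihoods evaluated on whole observation paths with densities on the finite
  product over \<open>{..n}\<close>.\<close>

lemma likelihood_restrict:
  "likelihood H \<theta> n (restrict y {..n}) = likelihood H \<theta> n y"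
  unfolding likelihood_def by (intro nn_integral_cong arg_cong[where f=ennreal] arg_cong2[where f="(*)"] prod.cong) auto

text \<open>Treats the initial density as kernel number 0 and lets all kernels take the full
  history, the form required by the Ionescu-Tulcea construction.\<close>

definition hmm_dens :: "('q, 'x, 'y) hmm \<Rightarrow> 'q \<Rightarrow> nat \<Rightarrow> (nat \<Rightarrow> 'x \<times> 'y) \<Rightarrow> 'x \<times> 'y \<Rightarrow> ennreal" where
  "hmm_dens H \<theta> i \<omega> z =
     (case i of
        0 \<Rightarrow> ennreal (stat_dens H \<theta> (fst z)) * ennreal (emit0_dens H \<theta> (fst z) (snd z))
      | Suc m \<Rightarrow> ennreal (trans_dens H \<theta> (fst (\<omega> m)) (fst z)) *
                 ennreal (emit_dens H \<theta> (fst z) (snd (\<omega> m)) (snd z)))"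

lemma hmm_law_eq:
  "hmm_law H \<theta> = projective_family.lim UNIV
     (Ionescu_Tulcea.CI (\<lambda>i \<omega>. density (joint H) (hmm_dens H \<theta> i \<omega>)) (\<lambda>_. joint H)) (\<lambda>_. joint H)"
proof -
  have "hmm_step H \<theta> (density (joint H) (\<lambda>(x, y). ennreal (stat_dens H \<theta> x) * ennreal (emit0_dens H \<theta> x y)))
      = (\<lambda>i \<omega>. density (joint H) (hmm_dens H \<theta> i \<omega>))"
    by (auto simp: fun_eq_iff hmm_step_def hmm_kernel_def hmm_dens_def[abs_def] split_beta' split: nat.split)
  then show ?thesis
    by (simp add: hmm_law_def path_law_def)
qed

text \<open>Covers every case of \<open>hmm_dens\<close>: a state is drawn first, then an
  observation given that state.\<close>

lemma nn_integral_chain_density: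
  assumes "sigma_finite_measure M" "sigma_finite_measure N"
    and [measurable]: "a \<in> borel_measurable M" "(\<lambda>(x, y). b x y) \<in> borel_measurable (M \<Otimes>\<^sub>M N)"
    and a: "(\<integral>\<^sup>+x. a x \<partial>M) = 1" and b: "\<And>x. x \<in> space M \<Longrightarrow> (\<integral>\<^sup>+y. b x y \<partial>N) = 1"
  shows "(\<integral>\<^sup>+z. a (fst z) * b (fst z) (snd z) \<partial>(M \<Otimes>\<^sub>M N)) = 1"
proof -
  interpret pair_sigma_finite M N
    by (intro pair_sigma_finite.intro assms)
  have "(\<integral>\<^sup>+z. a (fst z) * b (fst z) (snd z) \<partial>(M \<Otimes>\<^sub>M N)) = (\<integral>\<^sup>+x. (\<integral>\<^sup>+y. a x * b x y \<partial>N) \<partial>M)"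
    by (subst M2.nn_integral_fst[symmetric]) auto
  also have "\<dots> = (\<integral>\<^sup>+x. a x \<partial>M)"
    by (intro nn_integral_cong) (simp add: nn_integral_cmult b)
  finally show ?thesis
    by (simp add: a)
qed

section \<open>The model at one fixed parameter\<close>

context
  fixes H :: "('q::euclidean_space, 'x, 'y::euclidean_space) hmm" and \<theta> :: 'q
  assumes valid: "valid_hmm H" and \<theta>: "\<theta> \<in> Params H"
begin

lemma sigma_finite_Qx: "sigma_finite_measure (Qx H)"
  and sigma_finite_Qy: "sigma_finite_measure (Qy H)"
  and sets_Qy: "sets (Qy H) = sets borel"
  and measurable_trans_dens[measurable]:
    "(\<lambda>(x, x'). trans_dens H \<theta> x x') \<in> borel_measurable (Qx H \<Otimes>\<^sub>M Qx H)"
  and prob_density_trans_dens: "x \<in> space (Qx H) \<Longrightarrow> prob_density (Qx H) (trans_dens H \<theta> x)"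
  and prob_density_stat_dens: "prob_density (Qx H) (stat_dens H \<theta>)"
  and measurable_emit_dens[measurable]:
    "(\<lambda>(x, y, y'). emit_dens H \<theta> x y y') \<in> borel_measurable (Qx H \<Otimes>\<^sub>M Qy H \<Otimes>\<^sub>M Qy H)"
  and prob_density_emit_dens: "x \<in> space (Qx H) \<Longrightarrow> prob_density (Qy H) (emit_dens H \<theta> x y)"
  and measurable_emit0_dens[measurable]:
    "(\<lambda>(x, y). emit0_dens H \<theta> x y) \<in> borel_measurable (Qx H \<Otimes>\<^sub>M Qy H)"
  and prob_density_emit0_dens: "x \<in> space (Qx H) \<Longrightarrow> prob_density (Qy H) (emit0_dens H \<theta> x)"
  using valid \<theta> unfolding valid_hmm_def by blast+

lemma space_Qy: "space (Qy H) = UNIV"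
  using sets_eq_imp_space_eq[OF sets_Qy] by simp

lemma measurable_stat_dens[measurable]: "stat_dens H \<theta> \<in> borel_measurable (Qx H)"
  using prob_density_stat_dens by (simp add: prob_density_def)

lemma sigma_finite_joint: "sigma_finite_measure (joint H)"
  by (intro sigma_finite_pair_measure sigma_finite_Qx sigma_finite_Qy)

lemma measurable_hmm_dens:
  "(\<lambda>(\<omega>, z). hmm_dens H \<theta> i \<omega> z) \<in> borel_measurable (PiM {0..<i} (\<lambda>_. joint H) \<Otimes>\<^sub>M joint H)"
proof (cases i)
  case (Suc m)
  let ?M = "PiM {0..<i} (\<lambda>_. joint H) \<Otimes>\<^sub>M joint H"
  have [measurable]: "(\<lambda>p. fst p m) \<in> measurable ?M (joint H)"
    using Suc by (intro measurable_compose[OF measurable_fst] measurable_component_singleton) auto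
  have "(\<lambda>p. (fst (fst p m), fst (snd p))) \<in> measurable ?M (Qx H \<Otimes>\<^sub>M Qx H)"
    and "(\<lambda>p. (fst (snd p), snd (fst p m), snd (snd p))) \<in> measurable ?M (Qx H \<Otimes>\<^sub>M Qy H \<Otimes>\<^sub>M Qy H)"
    by measurable
  from this(1)[THEN measurable_compose, OF measurable_trans_dens]
    this(2)[THEN measurable_compose, OF measurable_emit_dens]
  show ?thesis
    by (simp add: Suc hmm_dens_def split_beta')
qed (auto simp: hmm_dens_def split_beta')

lemma nn_integral_hmm_dens:
  assumes "\<omega> \<in> space (PiM {0..<i} (\<lambda>_. joint H))"
  shows "(\<integral>\<^sup>+z. hmm_dens H \<theta> i \<omega> z \<partial>joint H) = 1"
proof (cases i)
  case 0
  show ?thesis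
    unfolding 0 hmm_dens_def nat.case
    using prob_density_stat_dens prob_density_emit0_dens
    by (intro nn_integral_chain_density[where a="\<lambda>x. ennreal (stat_dens H \<theta> x)"
          and b="\<lambda>x y. ennreal (emit0_dens H \<theta> x y)"] sigma_finite_Qx sigma_finite_Qy)
       (auto simp: prob_density_def)
next
  case (Suc m)
  have "\<omega> m \<in> space (joint H)"
    using assms Suc by (auto simp: space_PiM)
  then have m: "fst (\<omega> m) \<in> space (Qx H)" "snd (\<omega> m) \<in> space (Qy H)"
    by (auto simp: space_pair_measure)
  have "(\<lambda>(x, y). emit_dens H \<theta> x (snd (\<omega> m)) y) \<in> borel_measurable (joint H)"
  proof -
    have "(\<lambda>p. (fst p, snd (\<omega> m), snd p)) \<in> measurable (joint H) (Qx H \<Otimes>\<^sub>M Qy H \<Otimes>\<^sub>M Qy H)"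
      using m(2) by measurable
    from measurable_compose[OF this measurable_emit_dens] show ?thesis
      by (simp add: split_beta')
  qed
  then show ?thesis
    unfolding Suc hmm_dens_def nat.case
    using prob_density_trans_dens[OF m(1)] prob_density_emit_dens
    by (intro nn_integral_chain_density[where a="\<lambda>x. ennreal (trans_dens H \<theta> (fst (\<omega> m)) x)"
          and b="\<lambda>x y. ennreal (emit_dens H \<theta> x (snd (\<omega> m)) y)"] sigma_finite_Qx sigma_finite_Qy)
       (auto simp: prob_density_def split_beta')
qed

interpretation IT: Ionescu_Tulcea "\<lambda>i \<omega>. density (joint H) (hmm_dens H \<theta> i \<omega>)" "\<lambda>_. joint H"
  by (rule Ionescu_Tulcea_density[OF sigma_finite_joint measurable_hmm_dens nn_integral_hmm_dens])

lemma sets_hmm_law: "sets (hmm_law H \<theta>) = sets (PiM UNIV (\<lambda>_. joint H))"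
  by (simp add: hmm_law_eq)

lemma distr_hmm_law:
  "distr (hmm_law H \<theta>) (PiM {..n} (\<lambda>_. joint H)) (\<lambda>\<omega>. restrict \<omega> {..n})
   = density (PiM {..n} (\<lambda>_. joint H)) (\<lambda>\<omega>. \<Prod>i\<le>n. hmm_dens H \<theta> i (restrict \<omega> {0..<i}) (\<omega> i))"
  unfolding hmm_law_eq IT.distr_lim_atMost
  by (subst Ionescu_Tulcea_C_density[OF sigma_finite_joint measurable_hmm_dens nn_integral_hmm_dens])
     (simp_all add: lessThan_Suc_atMost atLeast0AtMost atLeastLessThanSuc_atLeastAtMost)

text \<open>Projecting to coordinate 0 preserves total mass, and the projected law is a stage of the
  construction, hence a probability measure.\<close>

lemma prob_space_hmm_law: "prob_space (hmm_law H \<theta>)"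
proof -
  have "prob_space (distr (hmm_law H \<theta>) (PiM {..0} (\<lambda>_. joint H)) (\<lambda>\<omega>. restrict \<omega> {..0}))"
    unfolding hmm_law_eq IT.distr_lim_atMost
    by (rule IT.prob_space_C) (simp add: space_PiM_empty)
  then show ?thesis
    by (rule prob_space_distrD[rotated])
       (simp add: measurable_cong_sets[OF sets_hmm_law refl] measurable_restrict_subset)
qed

text \<open>Non-negativity of the densities allows the product of \<open>ennreal\<close> kernel
  densities to be collected into one real product.\<close>

lemma prod_hmm_dens_zip:
  assumes x: "x \<in> space (PiM {..n} (\<lambda>_. Qx H))"
  shows "(\<Prod>i\<le>n. hmm_dens H \<theta> i (restrict (\<lambda>i\<in>{..n}. (x i, y i)) {0..<i}) ((\<lambda>i\<in>{..n}. (x i, y i)) i))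
     = ennreal (stat_dens H \<theta> (x 0) * emit0_dens H \<theta> (x 0) (y 0) *
             (\<Prod>t=1..n. trans_dens H \<theta> (x (t - 1)) (x t) * emit_dens H \<theta> (x t) (y (t - 1)) (y t)))"
proof -
  have sp: "x i \<in> space (Qx H)" if "i \<le> n" for i
    using x that by (auto simp: space_PiM)
  \<comment> \<open>At \<open>t = 0\<close> the truncated difference \<open>t - 1\<close> is 0, so
    all the indices are still at most \<open>n\<close>.\<close>
  have nonneg: "0 \<le> stat_dens H \<theta> (x 0)" "0 \<le> emit0_dens H \<theta> (x 0) (y 0)"
    "0 \<le> trans_dens H \<theta> (x (t - 1)) (x t)" "0 \<le> emit_dens H \<theta> (x t) (y (t - 1)) (y t)"
    if "t \<le> n" for t
    using sp[of 0] sp[OF that] sp[of "t - 1"] that prob_density_stat_dens prob_density_emit0_dens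
      prob_density_trans_dens prob_density_emit_dens
    by (auto simp: prob_density_def space_Qy)
  have "(\<Prod>i\<le>n. hmm_dens H \<theta> i (restrict (\<lambda>i\<in>{..n}. (x i, y i)) {0..<i}) ((\<lambda>i\<in>{..n}. (x i, y i)) i))
      = hmm_dens H \<theta> 0 (restrict (\<lambda>i\<in>{..n}. (x i, y i)) {0..<0}) ((\<lambda>i\<in>{..n}. (x i, y i)) 0) *
        (\<Prod>t=1..n. hmm_dens H \<theta> t (restrict (\<lambda>i\<in>{..n}. (x i, y i)) {0..<t}) ((\<lambda>i\<in>{..n}. (x i, y i)) t))"
  proof -
    have "{..n} = insert 0 {1..n}"
      by auto
    then have "prod f {..n} = f 0 * prod f {1..n}" for f :: "nat \<Rightarrow> ennreal"
      by simp
    then show ?thesis .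
  qed
  also have "(\<Prod>t=1..n. hmm_dens H \<theta> t (restrict (\<lambda>i\<in>{..n}. (x i, y i)) {0..<t}) ((\<lambda>i\<in>{..n}. (x i, y i)) t))
      = (\<Prod>t=1..n. ennreal (trans_dens H \<theta> (x (t - 1)) (x t) * emit_dens H \<theta> (x t) (y (t - 1)) (y t)))"
  proof (intro prod.cong refl)
    fix t assume t: "t \<in> {1..n}"
    then obtain m where "t = Suc m"
      by (cases t) auto
    with t nonneg(3,4)[of t] show "hmm_dens H \<theta> t (restrict (\<lambda>i\<in>{..n}. (x i, y i)) {0..<t}) ((\<lambda>i\<in>{..n}. (x i, y i)) t)
      = ennreal (trans_dens H \<theta> (x (t - 1)) (x t) * emit_dens H \<theta> (x t) (y (t - 1)) (y t))"
      by (simp add: hmm_dens_def ennreal_mult)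
  qed
  also have "\<dots> = ennreal (\<Prod>t=1..n. trans_dens H \<theta> (x (t - 1)) (x t) * emit_dens H \<theta> (x t) (y (t - 1)) (y t))"
    using nonneg by (intro prod_ennreal) auto
  finally show ?thesis
    by (rule trans) (use nonneg(1,2)[of 0] nonneg(3,4) in \<open>simp add: hmm_dens_def ennreal_mult' prod_nonneg\<close>)
qed

lemma distributed_likelihood:
  "distributed (hmm_law H \<theta>) (PiM {..n} (\<lambda>_. Qy H)) (\<lambda>\<omega>. \<lambda>i\<in>{..n}. snd (\<omega> i)) (likelihood H \<theta> n)"
proof -
  interpret X: product_sigma_finite "\<lambda>_. Qx H"
    by (rule product_sigma_finite.intro) (rule sigma_finite_Qx)
  interpret Y: product_sigma_finite "\<lambda>_. Qy H"
    by (rule product_sigma_finite.intro) (rule sigma_finite_Qy)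
  let ?J = "PiM {..n} (\<lambda>_. joint H)" and ?X = "PiM {..n} (\<lambda>_. Qx H)" and ?Y = "PiM {..n} (\<lambda>_. Qy H)"
  let ?zip = "\<lambda>(x :: nat \<Rightarrow> 'x, y :: nat \<Rightarrow> 'y). \<lambda>i\<in>{..n}. (x i, y i)" and ?snd = "\<lambda>\<omega> :: nat \<Rightarrow> 'x \<times> 'y. \<lambda>i\<in>{..n}. snd (\<omega> i)"
  let ?D = "\<lambda>\<omega>. \<Prod>i\<le>n. hmm_dens H \<theta> i (restrict \<omega> {0..<i}) (\<omega> i)"
  interpret P: pair_sigma_finite ?X ?Y
    by (intro pair_sigma_finite.intro X.sigma_finite Y.sigma_finite) auto
  have [measurable]: "?D \<in> borel_measurable ?J"
  proof (intro borel_measurable_prod_ennreal)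
    fix i assume "i \<in> {..n}"
    then have "(\<lambda>\<omega>. (restrict \<omega> {0..<i}, \<omega> i)) \<in> measurable ?J (PiM {0..<i} (\<lambda>_. joint H) \<Otimes>\<^sub>M joint H)"
      by (intro measurable_Pair measurable_restrict_subset measurable_component_singleton) auto
    from measurable_compose[OF this measurable_hmm_dens]
    show "(\<lambda>\<omega>. hmm_dens H \<theta> i (restrict \<omega> {0..<i}) (\<omega> i)) \<in> borel_measurable ?J"
      by simp
  qed
  have zip[measurable]: "?zip \<in> measurable (?X \<Otimes>\<^sub>M ?Y) ?J"
    unfolding split_beta'
    by (intro measurable_restrict measurable_Pair measurable_compose[OF measurable_fst]
        measurable_compose[OF measurable_snd] measurable_component_singleton)
  have snd[measurable]: "?snd \<in> measurable ?J ?Y"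
    by (intro measurable_restrict measurable_compose[OF measurable_component_singleton]) auto
  have D: "(\<lambda>(x, y). ?D (?zip (x, y))) \<in> borel_measurable (?X \<Otimes>\<^sub>M ?Y)"
    using measurable_compose[OF zip \<open>?D \<in> borel_measurable ?J\<close>] by (simp add: split_beta' del: restrict_apply restrict_restrict)
  \<comment> \<open>For each \<open>y\<close> the likelihood is the joint density with the hidden
    states integrated out; this also yields its measurability in \<open>y\<close>.\<close>
  have L: "likelihood H \<theta> n y = (\<integral>\<^sup>+x. ?D (?zip (x, y)) \<partial>?X)" for y
    unfolding likelihood_def
    by (intro nn_integral_cong) (simp only: prod.case prod_hmm_dens_zip)
  have L_meas[measurable]: "likelihood H \<theta> n \<in> borel_measurable ?Y"
    unfolding L[abs_def] by (rule P.M1.borel_measurable_nn_integral) (use D in simp)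
  have res[measurable]: "(\<lambda>\<omega>. restrict \<omega> {..n}) \<in> measurable (hmm_law H \<theta>) ?J"
    by (simp add: measurable_cong_sets[OF sets_hmm_law refl] measurable_restrict_subset)
  \<comment> \<open>The observations up to time \<open>n\<close> depend on the path through its
    restriction only, so the finite-dimensional density suffices.\<close>
  have snd_restrict: "(\<lambda>\<omega>. \<lambda>i\<in>{..n}. snd (\<omega> i)) = (\<lambda>\<omega>. ?snd (restrict \<omega> {..n}))"
    by (auto simp: fun_eq_iff)
  have "distr (hmm_law H \<theta>) ?Y ?snd = distr (density ?J ?D) ?Y ?snd"
    by (subst snd_restrict, subst distr_hmm_law[symmetric], subst distr_distr)
       (auto simp: comp_def)
  also have "\<dots> = density ?Y (likelihood H \<theta> n)"
  proof (rule measure_eqI)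
    fix A assume "A \<in> sets (distr (density ?J ?D) ?Y ?snd)"
    then have [measurable]: "A \<in> sets ?Y"
      by simp
    have "emeasure (distr (density ?J ?D) ?Y ?snd) A = (\<integral>\<^sup>+y. indicator A y \<partial>distr (density ?J ?D) ?Y ?snd)"
      by simp
    also have "\<dots> = (\<integral>\<^sup>+\<omega>. ?D \<omega> * indicator A (?snd \<omega>) \<partial>?J)"
      by (subst nn_integral_distr, simp, simp, subst nn_integral_density) auto
    \<comment> \<open>Splitting the space of pairs makes it possible to integrate over the states
      first, with the observations fixed.\<close>
    also have "\<dots> = (\<integral>\<^sup>+z. ?D (?zip z) * indicator A (?snd (?zip z)) \<partial>(?X \<Otimes>\<^sub>M ?Y))"
      by (subst PiM_pair_measure[OF _ sigma_finite_Qx sigma_finite_Qy], simp,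
          subst nn_integral_distr) auto
    also have "\<dots> = (\<integral>\<^sup>+y. (\<integral>\<^sup>+x. ?D (?zip (x, y)) * indicator A (?snd (?zip (x, y))) \<partial>?X) \<partial>?Y)"
      by (subst P.nn_integral_snd[symmetric]) auto
    also have "\<dots> = (\<integral>\<^sup>+y. (\<integral>\<^sup>+x. ?D (?zip (x, y)) * indicator A y \<partial>?X) \<partial>?Y)"
    proof (intro nn_integral_cong)
      fix x y assume "y \<in> space ?Y"
      \<comment> \<open>Points of the product space are \<open>undefined\<close> outside
        \<open>{..n}\<close>, so restriction does not change \<open>y\<close>.\<close>
      then have "?snd (?zip (x, y)) = y"
        by (auto simp: space_PiM fun_eq_iff PiE_iff extensional_def)
      then show "?D (?zip (x, y)) * indicator A (?snd (?zip (x, y))) = ?D (?zip (x, y)) * indicator A y"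
        by simp
    qed
    also have "\<dots> = (\<integral>\<^sup>+y. likelihood H \<theta> n y * indicator A y \<partial>?Y)"
    proof (intro nn_integral_cong)
      fix y assume y: "y \<in> space ?Y"
      have "(\<lambda>x. ?D (?zip (x, y))) \<in> borel_measurable ?X"
        using measurable_compose[OF measurable_Pair2'[OF y] D] by simp
      then show "(\<integral>\<^sup>+x. ?D (?zip (x, y)) * indicator A y \<partial>?X) = likelihood H \<theta> n y * indicator A y"
        unfolding L by (rule nn_integral_multc)
    qed
    also have "\<dots> = emeasure (density ?Y (likelihood H \<theta> n)) A"
      by (subst emeasure_density) auto
    finally show "emeasure (distr (density ?J ?D) ?Y ?snd) A = emeasure (density ?Y (likelihood H \<theta> n)) A" .
  qed simp
  finally show ?thesis
    unfolding distributed_def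
    using measurable_compose[OF res snd] by (simp add: snd_restrict[symmetric] cong: restrict_cong)
qed

end

subsection \<open>Non-negativity and additivity\<close>

theorem corollary1:
  fixes H :: "('q::euclidean_space, 'x, 'y::euclidean_space) hmm"
    and \<theta>0 \<theta>1 :: 'q and \<delta> :: real and K :: ereal
  assumes "valid_hmm H"
    and "C1 H \<theta>0" and "C1 H \<theta>1"
    and "0 < \<delta>" and "C2 H \<delta> \<theta>0"
    and "\<theta>1 \<in> nbhd H \<delta> \<theta>0"
    and "hmm_KL H \<theta>1 \<theta>0 K"
  shows "0 \<le> K \<and>
    (\<forall>(c1 :: 'y \<Rightarrow> 'a::euclidean_space) (c2 :: 'y \<Rightarrow> 'b::euclidean_space) R1 R2 l1 l2 K1 K2.
       splitting c1 c2 \<longrightarrow>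
       (\<forall>\<theta>\<in>{\<theta>0, \<theta>1}. component_likelihood H \<theta> c1 R1 (l1 \<theta>) \<and>
                     component_likelihood H \<theta> c2 R2 (l2 \<theta>)) \<longrightarrow>
       (\<forall>\<theta>\<in>{\<theta>0, \<theta>1}. \<forall>n y. likelihood H \<theta> n y =
          l1 \<theta> n (\<lambda>i\<in>{..n}. c1 (y i)) * l2 \<theta> n (\<lambda>i\<in>{..n}. c2 (y i))) \<longrightarrow>
       component_hmm_KL H c1 l1 \<theta>1 \<theta>0 K1 \<longrightarrow>
       component_hmm_KL H c2 l2 \<theta>1 \<theta>0 K2 \<longrightarrow>
       K = K1 + K2)"
proof (intro conjI allI impI)
  have \<theta>: "\<theta>0 \<in> Params H" "\<theta>1 \<in> Params H"
    using \<open>C2 H \<delta> \<theta>0\<close> \<open>\<theta>1 \<in> nbhd H \<delta> \<theta>0\<close> interior_subset by (auto simp: C2_def nbhd_def)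
  note P0 = prob_space_hmm_law[OF \<open>valid_hmm H\<close> \<theta>(1)]
  note P1 = prob_space_hmm_law[OF \<open>valid_hmm H\<close> \<theta>(2)]
  have K: "log_ratio_limit (hmm_law H \<theta>1) (\<lambda>n \<omega>. likelihood H \<theta>1 n (\<lambda>i. snd (\<omega> i)))
                              (\<lambda>n \<omega>. likelihood H \<theta>0 n (\<lambda>i. snd (\<omega> i))) K"
    using \<open>hmm_KL H \<theta>1 \<theta>0 K\<close> by (simp add: hmm_KL_def)
  then have "log_ratio_limit (hmm_law H \<theta>1) (\<lambda>n \<omega>. likelihood H \<theta>1 n (\<lambda>i\<in>{..n}. snd (\<omega> i)))
                              (\<lambda>n \<omega>. likelihood H \<theta>0 n (\<lambda>i\<in>{..n}. snd (\<omega> i))) K"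
    by (simp only: likelihood_restrict)
  then show "0 \<le> K"
    by (rule log_ratio_limit_nonneg[OF P1 P0 distributed_likelihood[OF \<open>valid_hmm H\<close> \<theta>(2)]
          distributed_likelihood[OF \<open>valid_hmm H\<close> \<theta>(1)]])
  fix c1 :: "'y \<Rightarrow> 'a" and c2 :: "'y \<Rightarrow> 'b" and R1 R2 l1 l2 K1 K2
  assume comp: "\<forall>\<theta>\<in>{\<theta>0, \<theta>1}. component_likelihood H \<theta> c1 R1 (l1 \<theta>) \<and> component_likelihood H \<theta> c2 R2 (l2 \<theta>)"
    and factor: "\<forall>\<theta>\<in>{\<theta>0, \<theta>1}. \<forall>n y. likelihood H \<theta> n y =
          l1 \<theta> n (\<lambda>i\<in>{..n}. c1 (y i)) * l2 \<theta> n (\<lambda>i\<in>{..n}. c2 (y i))"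
    and "component_hmm_KL H c1 l1 \<theta>1 \<theta>0 K1" and "component_hmm_KL H c2 l2 \<theta>1 \<theta>0 K2"
  then have K1: "log_ratio_limit (hmm_law H \<theta>1) (\<lambda>n \<omega>. l1 \<theta>1 n (\<lambda>i\<in>{..n}. c1 (snd (\<omega> i))))
                              (\<lambda>n \<omega>. l1 \<theta>0 n (\<lambda>i\<in>{..n}. c1 (snd (\<omega> i)))) K1"
    and K2: "log_ratio_limit (hmm_law H \<theta>1) (\<lambda>n \<omega>. l2 \<theta>1 n (\<lambda>i\<in>{..n}. c2 (snd (\<omega> i))))
                              (\<lambda>n \<omega>. l2 \<theta>0 n (\<lambda>i\<in>{..n}. c2 (snd (\<omega> i)))) K2"
    by (simp_all add: component_hmm_KL_def)
  have d: "\<And>n. distributed (hmm_law H \<theta>) (PiM {..n} (\<lambda>_. R1)) (\<lambda>\<omega>. \<lambda>i\<in>{..n}. c1 (snd (\<omega> i))) (l1 \<theta> n)"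
    "\<And>n. distributed (hmm_law H \<theta>) (PiM {..n} (\<lambda>_. R2)) (\<lambda>\<omega>. \<lambda>i\<in>{..n}. c2 (snd (\<omega> i))) (l2 \<theta> n)"
    if "\<theta> \<in> {\<theta>0, \<theta>1}" for \<theta>
    using comp that by (auto simp: component_likelihood_def)
  note d0 = d[of \<theta>0, simplified] and d1 = d[of \<theta>1, simplified]
  have "0 \<le> K1"
    using K1 by (rule log_ratio_limit_nonneg[OF P1 P0 d1(1) d0(1)])
  moreover have "0 \<le> K2"
    using K2 by (rule log_ratio_limit_nonneg[OF P1 P0 d1(2) d0(2)])
  \<comment> \<open>Addition on \<open>ereal\<close> is continuous at pairs of limits different from
    -\<infinity>, even when these are \<infinity>.\<close>
  ultimately have fin: "K1 \<noteq> -\<infinity>" "K2 \<noteq> -\<infinity>"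
    by auto
  interpret prob_space "hmm_law H \<theta>1" by (rule P1)
  \<comment> \<open>These are the side conditions of \<open>elog_ratio_add\<close>. Under the law of
    \<open>\<theta>1\<close> the likelihoods at \<open>\<theta>0\<close> are finite almost surely,
    but may vanish.\<close>
  have "AE \<omega> in hmm_law H \<theta>1. \<forall>n.
      l1 \<theta>1 n (\<lambda>i\<in>{..n}. c1 (snd (\<omega> i))) \<noteq> 0 \<and> l1 \<theta>1 n (\<lambda>i\<in>{..n}. c1 (snd (\<omega> i))) \<noteq> \<infinity> \<and>
      l2 \<theta>1 n (\<lambda>i\<in>{..n}. c2 (snd (\<omega> i))) \<noteq> 0 \<and> l2 \<theta>1 n (\<lambda>i\<in>{..n}. c2 (snd (\<omega> i))) \<noteq> \<infinity> \<and>
      l1 \<theta>0 n (\<lambda>i\<in>{..n}. c1 (snd (\<omega> i))) \<noteq> \<infinity> \<and> l2 \<theta>0 n (\<lambda>i\<in>{..n}. c2 (snd (\<omega> i))) \<noteq> \<infinity>"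
    unfolding AE_all_countable
    by (intro allI AE_conjI distributed_AE_nonzero[OF d1(1)] distributed_AE_nonzero[OF d1(2)]
        distributed_AE_finite[OF P1 d1(1) d1(1)] distributed_AE_finite[OF P1 d1(2) d1(2)]
        distributed_AE_finite[OF P0 d0(1) d1(1)] distributed_AE_finite[OF P0 d0(2) d1(2)])
  with K K1 K2
  have "AE \<omega> in hmm_law H \<theta>1. K = K1 + K2"
    unfolding log_ratio_limit_def
  proof eventually_elim
    case (elim \<omega>)
    let ?r = "\<lambda>a b n. (elog (a n) - elog (b n)) / ereal (real n)"
    let ?Y1 = "\<lambda>n. \<lambda>i\<in>{..n}. c1 (snd (\<omega> i))" and ?Y2 = "\<lambda>n. \<lambda>i\<in>{..n}. c2 (snd (\<omega> i))"
    have "eventually (\<lambda>n. ?r (\<lambda>n. likelihood H \<theta>1 n (\<lambda>i. snd (\<omega> i))) (\<lambda>n. likelihood H \<theta>0 n (\<lambda>i. snd (\<omega> i))) n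
        = ?r (\<lambda>n. l1 \<theta>1 n (?Y1 n)) (\<lambda>n. l1 \<theta>0 n (?Y1 n)) n
          + ?r (\<lambda>n. l2 \<theta>1 n (?Y2 n)) (\<lambda>n. l2 \<theta>0 n (?Y2 n)) n) sequentially"
      using eventually_gt_at_top[of 0]
    proof eventually_elim
      case (elim n)
      have "likelihood H \<theta> n (\<lambda>i. snd (\<omega> i)) = l1 \<theta> n (?Y1 n) * l2 \<theta> n (?Y2 n)"
        if "\<theta> \<in> {\<theta>0, \<theta>1}" for \<theta>
        using factor that by blast
      then show ?case
        using elim(1) \<open>\<forall>n. l1 \<theta>1 n _ \<noteq> 0 \<and> _\<close> by (simp add: elog_ratio_add)
    qed
    moreover have "(\<lambda>n. ?r (\<lambda>n. l1 \<theta>1 n (?Y1 n)) (\<lambda>n. l1 \<theta>0 n (?Y1 n)) n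
          + ?r (\<lambda>n. l2 \<theta>1 n (?Y2 n)) (\<lambda>n. l2 \<theta>0 n (?Y2 n)) n) \<longlonglongrightarrow> K1 + K2"
      using elim(2,3) fin by (intro tendsto_add_ereal_nonneg)
    ultimately have "?r (\<lambda>n. likelihood H \<theta>1 n (\<lambda>i. snd (\<omega> i))) (\<lambda>n. likelihood H \<theta>0 n (\<lambda>i. snd (\<omega> i))) \<longlonglongrightarrow> K1 + K2"
      by (simp add: tendsto_cong)
    then show ?case
      using elim(1) by (rule LIMSEQ_unique[rotated])
  qed
  \<comment> \<open>The equation does not involve the path, and in a probability space such a
    statement holds outright once it holds almost surely.\<close>
  then show "K = K1 + K2"
    by simp
qed

end
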